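(* Let $R_*=\frac{3-\sqrt5}{2}$ and $\varphi=\frac{1+\sqrt5}{2}$. There exist uncountably many real numbers $x$ which do not lie in the $PSL_2(\mathbb Z)$-orbit of $\varphi$ and for which the radius of convergence $R(x)$ of the series $[x]_q$ satisfies $R(x)\le R_*$.
   Context: For an integer $n\ge 0$ put $[n]_q=\frac{1-q^n}{1-q}$. Every real $x\ge1$ has a unique expansion $x=[[c_1,c_2,\ldots]]:=c_1-\frac{1}{c_2-\frac{1}{c_3-\cdots}}$ with integers $c_j\ge2$. For $x\ge 1$, $[x]_q\in\mathbb Z[[q]]$ is the $q$-adic limit as $N\to\infty$ of $[c_1]_q-\frac{q^{c_1-1}}{[c_2]_q-\cdots\frac{q^{c_{N-1}-1}}{[c_N]_q}}$; it is extended to all real $x$ (with values in $\mathbb Z((q))$) by the rule $[x+1]_q=q[x]_q+1$. $PSL_2(\mathbb Z)$ acts on the real projective line by fractional linear transformations. $R(x)$ is the radius of convergence of the Laurent series $[x]_q$ in $q$ (i.e. the reciprocal of $\limsup_n|\beta_n|^{1/n}$, where $\beta_n$ are its coefficients). *)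

theory Defs
  imports "HOL-Complex_Analysis.Complex_Analysis"
begin

text \<open>
  Series are taken in the field of formal Laurent series over the complex numbers, which contains
  \<open>\<int>((q))\<close>; the variable \<open>q\<close> is \<^const>\<open>fls_X\<close>. The metric on \<^typ>\<open>complex fls\<close> is the
  \<open>q\<close>-adic one.
\<close>

definition q_int :: "nat \<Rightarrow> complex fls" where
  "q_int n = (1 - fls_X ^ n) / (1 - fls_X)"

text \<open>
  Digit sequences are indexed from \<open>0\<close>, so \<open>c j\<close> stands for \<open>c\<^sub>j\<^sub>+\<^sub>1\<close>, and the truncation with
  index \<open>N\<close> involves the \<open>N + 1\<close> digits \<open>c 0, \<dots>, c N\<close>.
\<close>

fun neg_cfrac_trunc :: "(nat \<Rightarrow> nat) \<Rightarrow> nat \<Rightarrow> real" where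
  "neg_cfrac_trunc c 0 = real (c 0)"
| "neg_cfrac_trunc c (Suc N) = real (c 0) - 1 / neg_cfrac_trunc (\<lambda>j. c (Suc j)) N"

definition is_neg_cfrac_expansion :: "(nat \<Rightarrow> nat) \<Rightarrow> real \<Rightarrow> bool" where
  "is_neg_cfrac_expansion c x \<longleftrightarrow> (\<forall>j. c j \<ge> 2) \<and> neg_cfrac_trunc c \<longlonglongrightarrow> x"

definition neg_cfrac_digits :: "real \<Rightarrow> nat \<Rightarrow> nat" where
  "neg_cfrac_digits x = (THE c. is_neg_cfrac_expansion c x)"

fun q_cfrac_trunc :: "(nat \<Rightarrow> nat) \<Rightarrow> nat \<Rightarrow> complex fls" where
  "q_cfrac_trunc c 0 = q_int (c 0)"
| "q_cfrac_trunc c (Suc N) =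
     q_int (c 0) - fls_X ^ (c 0 - 1) / q_cfrac_trunc (\<lambda>j. c (Suc j)) N"

text \<open>
  For \<open>x < 1\<close> the recursion is the rule \<open>[x + 1]\<^sub>q = q [x]\<^sub>q + 1\<close> solved for \<open>[x]\<^sub>q\<close>.
\<close>

function q_real :: "real \<Rightarrow> complex fls" where
  "x \<ge> 1 \<Longrightarrow> q_real x = lim (q_cfrac_trunc (neg_cfrac_digits x))"
| "x < 1 \<Longrightarrow> q_real x = (q_real (x + 1) - 1) / fls_X"
  by force+
termination
  by (relation "Wellfounded.measure (\<lambda>x. nat \<lceil>1 - x\<rceil>)") (auto, linarith)

text \<open>
  The real points of the orbit of \<open>x\<close> under fractional linear transformations of the real
  projective line; a vanishing denominator corresponds to the image \<open>\<infinity>\<close>.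
\<close>

definition PSL2Z_orbit :: "real \<Rightarrow> real set" where
  "PSL2Z_orbit x =
     {(of_int a * x + of_int b) / (of_int c * x + of_int d) | a b c d :: int.
        a * d - b * c = 1 \<and> of_int c * x + of_int d \<noteq> 0}"

end

theory Submission
  imports Defs
begin

text \<open>
  The numbers wanted are produced by a diagonal argument on digit sequences; write \<open>R\<close> for
  \<open>(3 - \<surd>5) / 2\<close>. Two facts make it work.

  First, radius at most \<open>R\<close> is dense. A number whose digits are eventually \<open>3\<close> has a
  \<open>q\<close>-deformation obtained from that of \<open>[[3,3,\<dots>]]\<close> by finitely many fractional linear
  maps with polynomial coefficients in \<open>q\<close>. The series \<open>Y\<close> of \<open>[[3,3,\<dots>]]\<close> is quadratic over the
  polynomials, with discriminant \<open>(1 + 3q + q\<^sup>2)(1 - q + q\<^sup>2)\<close>, which has a simple zero at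
  \<open>-R\<close>. If the deformed number converged on a disc of radius larger than \<open>R\<close>, undoing the
  fractional linear maps would make \<open>Y\<close> meromorphic there, and the discriminant would be the square
  of a meromorphic function although its order at \<open>-R\<close> is odd
  (\<open>square_eq_mult_square_simple_zero\<close>, \<open>threes_not_mero_on_disc\<close>). Hence for every
  \<open>\<rho> > R\<close> there are arbitrarily large \<open>n\<close> with \<open>|\<beta>\<^sub>n| \<rho>\<^sup>n \<ge> 1\<close>
  (\<open>large_coefficient\<close>).

  Second, the \<open>n\<close>-th coefficient is determined by the first \<open>n + 1\<close> digits
  (\<open>q_cfrac_fps_nth_cong\<close>), so a large coefficient, once found, survives every later change of
  digits.

  Given any sequence of reals one can therefore alternate two moves on a finite prefix: extend it by
  enough digits \<open>3\<close> to fix a large coefficient for \<open>\<rho> = R + 1 / (k + 1)\<close>, then append a digit on which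
  it differs from the \<open>k\<close>-th real (\<open>diagonal_digits\<close>). The limit has radius at most \<open>R\<close> and, as
  expansions are unique, differs from all listed reals. If the set in question were countable, the
  list could exhaust its union with the countable orbit of the golden ratio, a contradiction.
\<close>

unbundle no vec_syntax

section \<open>Negative continued fractions of real numbers\<close>

lemma neg_cfrac_trunc_gt_1:
  assumes "\<forall>j. c j \<ge> 2"
  shows "neg_cfrac_trunc c N > 1"
  using assms
proof (induction N arbitrary: c)
  case 0
  then have "2 \<le> c 0" by blast
  then show ?case by simp
next
  case (Suc N)
  have "neg_cfrac_trunc (\<lambda>j. c (Suc j)) N > 1"
    by (rule Suc.IH) (use Suc.prems in blast)
  then have "1 / neg_cfrac_trunc (\<lambda>j. c (Suc j)) N < 1" by simp
  moreover have "real (c 0) \<ge> 2" using Suc.prems by (metis of_nat_le_iff of_nat_numeral)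
  ultimately show ?case by simp
qed

text \<open>
  Together with the lower bound \<open>1\<close>, monotonicity makes every sequence of digits at least \<open>2\<close> the
  expansion of some real.
\<close>

lemma neg_cfrac_trunc_Suc_le:
  assumes "\<forall>j. c j \<ge> 2"
  shows "neg_cfrac_trunc c (Suc N) \<le> neg_cfrac_trunc c N"
  using assms
proof (induction N arbitrary: c)
  case 0
  have "neg_cfrac_trunc (\<lambda>j. c (Suc j)) 0 > 1"
    using 0 by (intro neg_cfrac_trunc_gt_1) blast
  then show ?case by simp
next
  case (Suc N)
  let ?t = "neg_cfrac_trunc (\<lambda>j. c (Suc j))"
  have "?t (Suc N) \<le> ?t N" by (rule Suc.IH) (use Suc.prems in blast)
  moreover have "?t (Suc N) > 1"
    by (rule neg_cfrac_trunc_gt_1) (use Suc.prems in blast)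
  ultimately have "1 / ?t N \<le> 1 / ?t (Suc N)" by (intro divide_left_mono) auto
  then show ?case
    by (simp only: neg_cfrac_trunc.simps(2)[of c "Suc N"] neg_cfrac_trunc.simps(2)[of c N])
qed

lemma neg_cfrac_expansion_exists:
  assumes "\<forall>j. c j \<ge> 2"
  obtains x where "is_neg_cfrac_expansion c x" "x \<ge> 1"
proof -
  have lower: "neg_cfrac_trunc c N \<ge> 1" for N
    using neg_cfrac_trunc_gt_1[OF assms, of N] by simp
  have "decseq (neg_cfrac_trunc c)"
    unfolding decseq_Suc_iff using neg_cfrac_trunc_Suc_le[OF assms] by blast
  then obtain x where x: "neg_cfrac_trunc c \<longlonglongrightarrow> x"
    using decseq_convergent[of "neg_cfrac_trunc c" 1] lower by blast
  moreover have "x \<ge> 1"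
    using LIMSEQ_le_const[OF x] lower by blast
  ultimately show ?thesis
    using that assms unfolding is_neg_cfrac_expansion_def by blast
qed

lemma neg_cfrac_expansion_decompose:
  assumes "is_neg_cfrac_expansion c x"
  obtains y where "is_neg_cfrac_expansion (\<lambda>j. c (Suc j)) y" "y \<ge> 1" "x = real (c 0) - 1 / y"
proof -
  have "\<forall>j. c (Suc j) \<ge> 2"
    using assms unfolding is_neg_cfrac_expansion_def by blast
  then obtain y where y: "is_neg_cfrac_expansion (\<lambda>j. c (Suc j)) y" "y \<ge> 1"
    using neg_cfrac_expansion_exists[of "\<lambda>j. c (Suc j)"] by blast
  have "(\<lambda>N. neg_cfrac_trunc c (Suc N)) \<longlonglongrightarrow> real (c 0) - 1 / y"
    using y unfolding is_neg_cfrac_expansion_def neg_cfrac_trunc.simps(2)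
    by (intro tendsto_diff tendsto_divide tendsto_const) auto
  moreover have "(\<lambda>N. neg_cfrac_trunc c (Suc N)) \<longlonglongrightarrow> x"
    using assms unfolding is_neg_cfrac_expansion_def by (simp only: filterlim_sequentially_Suc)
  ultimately have "x = real (c 0) - 1 / y"
    using LIMSEQ_unique by blast
  then show ?thesis using y that by blast
qed

text \<open>
  The tail value \<open>y \<ge> 1\<close> satisfies \<open>0 < 1 / y \<le> 1\<close>, so \<open>x\<close> lies in the half-open interval
  \<open>[c 0 - 1, c 0)\<close>. Reading off one digit at a time in this way yields uniqueness of the expansion.
\<close>

lemma neg_cfrac_expansion_hd:
  assumes "is_neg_cfrac_expansion c x"
  shows "int (c 0) = \<lfloor>x\<rfloor> + 1"
proof -
  obtain y where y: "y \<ge> 1" "x = real (c 0) - 1 / y"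
    using neg_cfrac_expansion_decompose[OF assms] by blast
  then have "0 < 1 / y" "1 / y \<le> 1" by auto
  then have "\<lfloor>x\<rfloor> = int (c 0) - 1"
    using y(2) by (intro floor_unique) auto
  then show ?thesis by simp
qed

lemma neg_cfrac_expansion_unique:
  assumes "is_neg_cfrac_expansion c x" "is_neg_cfrac_expansion d x"
  shows "c = d"
proof
  fix j
  show "c j = d j"
    using assms
  proof (induction j arbitrary: c d x)
    case 0
    then show ?case using neg_cfrac_expansion_hd[of c x] neg_cfrac_expansion_hd[of d x] by simp
  next
    case (Suc j)
    obtain y where y: "is_neg_cfrac_expansion (\<lambda>j. c (Suc j)) y" "x = real (c 0) - 1 / y"
      using neg_cfrac_expansion_decompose[OF Suc.prems(1)] by blast
    obtain z where z: "is_neg_cfrac_expansion (\<lambda>j. d (Suc j)) z" "x = real (d 0) - 1 / z"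
      using neg_cfrac_expansion_decompose[OF Suc.prems(2)] by blast
    have "c 0 = d 0"
      using neg_cfrac_expansion_hd[of c x] neg_cfrac_expansion_hd[of d x] Suc.prems by simp
    then have "y = z" using y(2) z(2) by simp
    then show ?case using Suc.IH[OF y(1)] z(1) by simp
  qed
qed

lemma neg_cfrac_digits_eq:
  assumes "is_neg_cfrac_expansion c x"
  shows "neg_cfrac_digits x = c"
  unfolding neg_cfrac_digits_def
  using assms neg_cfrac_expansion_unique by blast

section \<open>The power series of a digit sequence\<close>

text \<open>
  For digits at least \<open>2\<close> every denominator has constant term \<open>1\<close>, so the truncations are power
  series and the division is multiplication by a power series inverse.
\<close>

fun q_cfrac_trunc_fps :: "(nat \<Rightarrow> nat) \<Rightarrow> nat \<Rightarrow> complex fps" where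
  "q_cfrac_trunc_fps c 0 = (\<Sum>i<c 0. fps_X ^ i)"
| "q_cfrac_trunc_fps c (Suc N) =
     (\<Sum>i<c 0. fps_X ^ i) - fps_X ^ (c 0 - 1) * inverse (q_cfrac_trunc_fps (\<lambda>j. c (Suc j)) N)"

text \<open>
  The diagonal picks each coefficient at a truncation from which on it no longer changes.
\<close>

definition q_cfrac_fps :: "(nat \<Rightarrow> nat) \<Rightarrow> complex fps" where
  "q_cfrac_fps c = Abs_fps (\<lambda>n. q_cfrac_trunc_fps c n $ n)"

lemma q_int_eq_fps: "q_int n = fps_to_fls (\<Sum>i<n. fps_X ^ i)"
proof -
  have "(1 - fps_X) * (\<Sum>i<n. fps_X ^ i) = (1 - fps_X ^ n :: complex fps)"
    by (simp add: one_diff_power_eq)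
  from arg_cong[OF this, of fps_to_fls]
  have "(1 - fls_X) * fps_to_fls (\<Sum>i<n. fps_X ^ i) = (1 - fls_X ^ n :: complex fls)"
    by (simp add: fls_times_fps_to_fls fps_to_fls_power)
  moreover have "(1 - fls_X :: complex fls) \<noteq> 0"
  proof
    assume "(1 - fls_X :: complex fls) = 0"
    then have "fls_nth (1 - fls_X :: complex fls) 0 = 0" by simp
    then show False by simp
  qed
  ultimately show ?thesis
    unfolding q_int_def by (simp add: field_simps)
qed

lemma fps_nth_0_sum_X_power: "n \<ge> 1 \<Longrightarrow> (\<Sum>i<n. fps_X ^ i :: complex fps) $ 0 = 1"
  by (cases n) (auto simp: fps_sum_nth sum.lessThan_Suc_shift simp del: sum.lessThan_Suc)

lemma q_cfrac_trunc_fps_nth_0: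
  assumes "\<forall>j. c j \<ge> 2"
  shows "q_cfrac_trunc_fps c N $ 0 = 1"
proof -
  have "c 0 \<ge> 2" using assms by blast
  then show ?thesis
    by (cases N) (auto simp: fps_nth_0_sum_X_power)
qed

lemma q_cfrac_trunc_eq_fps:
  assumes "\<forall>j. c j \<ge> 2"
  shows "q_cfrac_trunc c N = fps_to_fls (q_cfrac_trunc_fps c N)"
  using assms
proof (induction N arbitrary: c)
  case 0
  then show ?case by (simp add: q_int_eq_fps)
next
  case (Suc N)
  let ?t = "q_cfrac_trunc_fps (\<lambda>j. c (Suc j)) N"
  have "?t $ 0 = 1" using Suc.prems by (intro q_cfrac_trunc_fps_nth_0) blast
  then have "inverse (fps_to_fls ?t) = fps_to_fls (inverse ?t)"
    by (intro fls_inverse_fps_to_fls) simp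
  moreover have "q_cfrac_trunc (\<lambda>j. c (Suc j)) N = fps_to_fls ?t"
    by (rule Suc.IH) (use Suc.prems in blast)
  ultimately show ?case
    by (simp add: q_int_eq_fps divide_inverse fls_times_fps_to_fls fps_to_fls_power)
qed

lemma fps_nth_inverse_cong:
  fixes f g :: "complex fps"
  assumes "f $ 0 \<noteq> 0" "g $ 0 \<noteq> 0" "\<And>i. i \<le> n \<Longrightarrow> f $ i = g $ i"
  shows "inverse f $ n = inverse g $ n"
proof -
  have "inverse f * f = 1" "inverse g * g = 1"
    using assms(1,2) by (simp_all add: inverse_mult_eq_1)
  then have "inverse f - inverse g = (g - f) * (inverse f * inverse g)"
    by algebra
  then have "(inverse f - inverse g) $ n = 0"
    using assms(3) by (simp add: fps_mult_nth)
  then show ?thesis by simp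
qed

text \<open>
  This single statement gives both the \<open>q\<close>-adic convergence of the truncations (take \<open>d = c\<close>) and
  the dependence of low coefficients on few digits only (take \<open>M = N\<close>). The induction gains one
  coefficient per digit because the factor \<open>fps_X ^ (c 0 - 1)\<close> in front of the inverse has exponent
  at least \<open>1\<close>.
\<close>

lemma q_cfrac_trunc_fps_nth_cong:
  assumes "\<forall>j. c j \<ge> 2" "\<forall>j. d j \<ge> 2"
    and "\<And>j. j \<le> n \<Longrightarrow> c j = d j" "n \<le> N" "n \<le> M" "i \<le> n"
  shows "q_cfrac_trunc_fps c N $ i = q_cfrac_trunc_fps d M $ i"
  using assms
proof (induction n arbitrary: c d N M i)
  case 0
  then show ?case using q_cfrac_trunc_fps_nth_0 by simp
next
  case (Suc n)
  obtain N' M' where NM: "N = Suc N'" "M = Suc M'" "n \<le> N'" "n \<le> M'"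
    using Suc.prems(4,5) by (metis Suc_le_D Suc_le_mono)
  let ?c = "\<lambda>j. c (Suc j)" and ?d = "\<lambda>j. d (Suc j)"
  have ge2: "\<forall>j. ?c j \<ge> 2" "\<forall>j. ?d j \<ge> 2"
    using Suc.prems by blast+
  have IH: "q_cfrac_trunc_fps ?c N' $ k = q_cfrac_trunc_fps ?d M' $ k" if "k \<le> n" for k
    using Suc.prems(3) NM that by (intro Suc.IH ge2) auto
  have hd: "c 0 = d 0" "c 0 \<ge> 2" using Suc.prems by auto
  have "inverse (q_cfrac_trunc_fps ?c N') $ k = inverse (q_cfrac_trunc_fps ?d M') $ k"
    if "k \<le> n" for k
    by (intro fps_nth_inverse_cong)
      (use that in \<open>auto simp: IH q_cfrac_trunc_fps_nth_0[OF ge2(1)] q_cfrac_trunc_fps_nth_0[OF ge2(2)]\<close>)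
  then show ?case
    using hd Suc.prems(6) by (auto simp: NM fps_X_power_mult_nth)
qed

lemma q_cfrac_fps_nth:
  assumes "\<forall>j. c j \<ge> 2" "n \<le> N"
  shows "q_cfrac_fps c $ n = q_cfrac_trunc_fps c N $ n"
  unfolding q_cfrac_fps_def
  using q_cfrac_trunc_fps_nth_cong[OF assms(1,1), of n n N n] assms(2) by simp

lemma q_cfrac_fps_nth_cong:
  assumes "\<forall>j. c j \<ge> 2" "\<forall>j. d j \<ge> 2" "\<And>j. j \<le> n \<Longrightarrow> c j = d j"
  shows "q_cfrac_fps c $ n = q_cfrac_fps d $ n"
  unfolding q_cfrac_fps_def
  using q_cfrac_trunc_fps_nth_cong[OF assms, of n n n] by simp

lemma q_cfrac_fps_nth_0:
  assumes "\<forall>j. c j \<ge> 2"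
  shows "q_cfrac_fps c $ 0 = 1"
  by (simp add: q_cfrac_fps_def q_cfrac_trunc_fps_nth_0[OF assms] del: q_cfrac_trunc_fps.simps)

text \<open>
  The embedding is an isometry, so convergence can be checked coefficientwise on power series.
\<close>

lemma dist_fps_to_fls: "dist (fps_to_fls a) (fps_to_fls b) = dist a (b :: 'a :: group_add fps)"
  by (simp add: dist_fls_def dist_fps_def fls_subdegree_fls_to_fps flip: fps_to_fls_minus)

lemma q_cfrac_trunc_tendsto:
  assumes "\<forall>j. c j \<ge> 2"
  shows "q_cfrac_trunc c \<longlonglongrightarrow> fps_to_fls (q_cfrac_fps c)"
proof -
  have "q_cfrac_trunc_fps c \<longlonglongrightarrow> q_cfrac_fps c"
  proof (rule tendsto_fpsI)
    fix n
    show "\<forall>\<^sub>F N in sequentially. q_cfrac_trunc_fps c N $ n = q_cfrac_fps c $ n"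
      using eventually_ge_at_top[of n]
      by eventually_elim (simp add: q_cfrac_fps_nth[OF assms])
  qed
  then show ?thesis
    unfolding tendsto_iff by (simp add: q_cfrac_trunc_eq_fps[OF assms] dist_fps_to_fls)
qed

lemma q_real_eq_fps:
  assumes "is_neg_cfrac_expansion c x" "x \<ge> 1"
  shows "q_real x = fps_to_fls (q_cfrac_fps c)"
proof -
  have "\<forall>j. c j \<ge> 2" using assms(1) by (simp add: is_neg_cfrac_expansion_def)
  then show ?thesis
    using assms by (simp add: neg_cfrac_digits_eq limI q_cfrac_trunc_tendsto)
qed

text \<open>
  The functional equation \<open>[x] = [c\<^sub>1] - q\<^bsup>c\<^sub>1 - 1\<^esup> / [x']\<close> cleared of its denominator. In this
  form both sides are polynomial in the coefficients, so that each coefficient can be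
  compared with that of a truncation without any continuity argument.
\<close>

lemma q_cfrac_fps_unfold:
  assumes "\<forall>j. c j \<ge> 2"
  shows "q_cfrac_fps c * q_cfrac_fps (\<lambda>j. c (Suc j)) =
    (\<Sum>i<c 0. fps_X ^ i) * q_cfrac_fps (\<lambda>j. c (Suc j)) - fps_X ^ (c 0 - 1)"
proof (rule fps_ext)
  fix n
  let ?c = "\<lambda>j. c (Suc j)"
  let ?t = "q_cfrac_trunc_fps ?c n"
  have ge2: "\<forall>j. ?c j \<ge> 2" using assms by blast
  have "?t $ 0 = 1" by (rule q_cfrac_trunc_fps_nth_0[OF ge2])
  then have inv: "inverse ?t * ?t = 1" by (intro inverse_mult_eq_1) simp
  have step: "q_cfrac_trunc_fps c (Suc n) * ?t = (\<Sum>i<c 0. fps_X ^ i) * ?t - fps_X ^ (c 0 - 1)"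
    using inv by (simp add: left_diff_distrib mult.assoc)
  have "(q_cfrac_fps c * q_cfrac_fps ?c) $ n = (q_cfrac_trunc_fps c (Suc n) * ?t) $ n"
    unfolding fps_mult_nth
    by (intro sum.cong refl arg_cong2[of _ _ _ _ "(*)"] q_cfrac_fps_nth assms ge2) auto
  also have "\<dots> = ((\<Sum>i<c 0. fps_X ^ i) * q_cfrac_fps ?c - fps_X ^ (c 0 - 1)) $ n"
    unfolding step fps_sub_nth fps_mult_nth
    by (intro sum.cong refl arg_cong2[of _ _ _ _ "(*)"] arg_cong2[of _ _ _ _ "(-)"]
        q_cfrac_fps_nth[symmetric] assms ge2) auto
  finally show "(q_cfrac_fps c * q_cfrac_fps ?c) $ n = \<dots>" .
qed

section \<open>Quotients of power series converging on a common disc\<close>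

text \<open>
  These are expansions at \<open>0\<close> of meromorphic functions on the disc of radius \<open>\<rho>\<close>. Writing
  them as quotients of power series keeps all identities inside the field of Laurent series;
  analysis enters only where orders of vanishing are compared.
\<close>

definition mero_on_disc :: "real \<Rightarrow> complex fls set" where
  "mero_on_disc \<rho> = {fps_to_fls A / fps_to_fls B | A B.
     B \<noteq> 0 \<and> fps_conv_radius A \<ge> ereal \<rho> \<and> fps_conv_radius B \<ge> ereal \<rho>}"

lemma quotient_in_mero_on_disc:
  assumes "F = fps_to_fls A / fps_to_fls B" "B \<noteq> 0"
    and "fps_conv_radius A \<ge> ereal \<rho>" "fps_conv_radius B \<ge> ereal \<rho>"
  shows "F \<in> mero_on_disc \<rho>"
  unfolding mero_on_disc_def using assms by blast

lemma mero_on_discI: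
  assumes "fps_conv_radius A \<ge> ereal \<rho>"
  shows "fps_to_fls A \<in> mero_on_disc \<rho>"
  by (rule quotient_in_mero_on_disc[of _ A 1]) (use assms in auto)

lemma fps_conv_radius_mult_ge:
  assumes "fps_conv_radius A \<ge> r" "fps_conv_radius (B :: complex fps) \<ge> r"
  shows "fps_conv_radius (A * B) \<ge> r"
  using fps_conv_radius_mult[of A B] assms by (meson min.boundedI order_trans)

lemma fps_conv_radius_diff_ge:
  assumes "fps_conv_radius A \<ge> r" "fps_conv_radius (B :: complex fps) \<ge> r"
  shows "fps_conv_radius (A - B) \<ge> r"
  using fps_conv_radius_diff[of A B] assms by (meson min.boundedI order_trans)

lemma mero_on_disc_diff:
  assumes "F \<in> mero_on_disc \<rho>" "G \<in> mero_on_disc \<rho>"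
  shows "F - G \<in> mero_on_disc \<rho>"
proof -
  obtain A B where F: "F = fps_to_fls A / fps_to_fls B" "B \<noteq> 0"
    "fps_conv_radius A \<ge> ereal \<rho>" "fps_conv_radius B \<ge> ereal \<rho>"
    using assms(1) unfolding mero_on_disc_def by blast
  obtain C D where G: "G = fps_to_fls C / fps_to_fls D" "D \<noteq> 0"
    "fps_conv_radius C \<ge> ereal \<rho>" "fps_conv_radius D \<ge> ereal \<rho>"
    using assms(2) unfolding mero_on_disc_def by blast
  have "F - G = fps_to_fls (A * D - C * B) / fps_to_fls (B * D)"
    using F(2) G(2) by (simp add: F(1) G(1) diff_frac_eq fls_times_fps_to_fls)
  then show ?thesis
    using F(2-) G(2-)
    by (intro quotient_in_mero_on_disc[of _ "A * D - C * B" "B * D"]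
        fps_conv_radius_mult_ge fps_conv_radius_diff_ge) auto
qed

lemma mero_on_disc_divide:
  assumes "F \<in> mero_on_disc \<rho>" "G \<in> mero_on_disc \<rho>" "G \<noteq> 0"
  shows "F / G \<in> mero_on_disc \<rho>"
proof -
  obtain A B where F: "F = fps_to_fls A / fps_to_fls B" "B \<noteq> 0"
    "fps_conv_radius A \<ge> ereal \<rho>" "fps_conv_radius B \<ge> ereal \<rho>"
    using assms(1) unfolding mero_on_disc_def by blast
  obtain C D where G: "G = fps_to_fls C / fps_to_fls D" "D \<noteq> 0"
    "fps_conv_radius C \<ge> ereal \<rho>" "fps_conv_radius D \<ge> ereal \<rho>"
    using assms(2) unfolding mero_on_disc_def by blast
  have "C \<noteq> 0" using assms(3) G(1) by auto
  moreover have "F / G = fps_to_fls (A * D) / fps_to_fls (B * C)"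
    by (simp add: F(1) G(1) fls_times_fps_to_fls)
  ultimately show ?thesis
    using F(2-) G(2-)
    by (intro quotient_in_mero_on_disc[of _ "A * D" "B * C"] fps_conv_radius_mult_ge) auto
qed

lemma fps_conv_radius_X_power_sum: "fps_conv_radius (\<Sum>i<n. fps_X ^ i :: complex fps) = \<infinity>"
proof (induction n)
  case (Suc n)
  have "fps_conv_radius ((\<Sum>i<n. fps_X ^ i) + fps_X ^ n :: complex fps) \<ge> \<infinity>"
    using fps_conv_radius_add[of "\<Sum>i<n. fps_X ^ i :: complex fps" "fps_X ^ n"] Suc by simp
  then show ?case by simp
qed simp

text \<open>
  Solving the functional equation for the tail expresses it as a fractional linear function
  of the whole series with polynomial coefficients, so removing digits does not leave the field of
  meromorphic functions on the disc. Convergence itself may be lost in this step, which is why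
  the weaker property is propagated.
\<close>

lemma mero_on_disc_tail:
  assumes "\<forall>j. c j \<ge> 2" "fps_to_fls (q_cfrac_fps c) \<in> mero_on_disc \<rho>"
  shows "fps_to_fls (q_cfrac_fps (\<lambda>j. c (m + j))) \<in> mero_on_disc \<rho>"
proof (induction m)
  case 0
  then show ?case using assms by simp
next
  case (Suc m)
  define d where "d = (\<lambda>j. c (m + j))"
  define X where "X = fps_to_fls (q_cfrac_fps d)"
  define Y where "Y = fps_to_fls (q_cfrac_fps (\<lambda>j. d (Suc j)))"
  define S :: "complex fls" where "S = fps_to_fls (\<Sum>i<d 0. fps_X ^ i)"
  define P :: "complex fls" where "P = fps_to_fls (fps_X ^ (d 0 - 1))"
  have ge2: "\<forall>j. d j \<ge> 2" using assms(1) unfolding d_def by blast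
  have "X * Y = S * Y - P"
    unfolding X_def Y_def S_def P_def
    using arg_cong[OF q_cfrac_fps_unfold[OF ge2], of fps_to_fls]
    by (simp add: fls_times_fps_to_fls)
  then have "Y * (S - X) = P" by (simp add: algebra_simps)
  moreover have "P \<noteq> 0" unfolding P_def by simp
  ultimately have nz: "S - X \<noteq> 0" and Y: "Y = P / (S - X)"
    by (auto simp: eq_divide_eq)
  have "X \<in> mero_on_disc \<rho>" using Suc unfolding X_def d_def .
  moreover have "S \<in> mero_on_disc \<rho>" "P \<in> mero_on_disc \<rho>"
    unfolding S_def P_def by (intro mero_on_discI; simp add: fps_conv_radius_X_power_sum)+
  ultimately have "Y \<in> mero_on_disc \<rho>"
    unfolding Y using nz by (intro mero_on_disc_divide mero_on_disc_diff)
  then show ?case by (simp add: Y_def d_def)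
qed

lemma eventually_eval_fps_nonzero:
  assumes "fps_conv_radius A \<ge> ereal \<rho>" "A \<noteq> 0" "norm z < \<rho>"
  shows "eventually (\<lambda>w. eval_fps A w \<noteq> (0::complex)) (at z)"
proof -
  have pos: "\<rho> > 0" using assms(3) norm_ge_zero[of z] by linarith
  have "\<exists>w\<in>ball 0 \<rho>. eval_fps A w \<noteq> 0"
  proof (rule ccontr)
    assume zero: "\<not> ?thesis"
    have "eventually (\<lambda>w. w \<in> ball 0 \<rho>) (nhds (0::complex))"
      using pos by (intro eventually_nhds_in_open) auto
    then have "eventually (\<lambda>w. eval_fps A w = eval_fps 0 w) (nhds 0)"
      by eventually_elim (use zero in auto)
    moreover have "fps_conv_radius A > 0"
      using assms(1) pos by (metis ereal_less(2) less_le_trans)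
    ultimately have "A = 0" by (intro eval_fps_eqD) auto
    then show False using assms(2) by blast
  qed
  then obtain \<beta> where \<beta>: "\<beta> \<in> ball 0 \<rho>" "eval_fps A \<beta> \<noteq> 0" by blast
  have "eval_fps A holomorphic_on ball 0 \<rho>"
    using assms(1)
    by (intro holomorphic_on_eval_fps subsetI) (simp, meson ereal_less_le less_ereal.simps(1) less_le_trans)
  then have "\<forall>\<^sub>F w in at z. eval_fps A w \<noteq> 0 \<and> w \<in> ball 0 \<rho>"
    using assms(3) \<beta> by (intro non_zero_neighbour_alt[of _ "ball 0 \<rho>" z \<beta>]) auto
  then show ?thesis by (auto elim: eventually_mono)
qed

text \<open>
  The left-hand side vanishes at \<open>z\<close> to even order, the right-hand side to odd order.
\<close>

lemma square_eq_mult_square_simple_zero: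
  assumes "fps_conv_radius A \<ge> ereal \<rho>" "fps_conv_radius B \<ge> ereal \<rho>" "B \<noteq> 0"
    and "norm z < \<rho>" "g analytic_on {z}" "g z \<noteq> 0"
    and eq: "\<And>w. norm w < \<rho> \<Longrightarrow>
      eval_fps A w * eval_fps A w = ((w - z) * g w) * (eval_fps B w * eval_fps B w)"
  shows False
proof -
  define D where "D = (\<lambda>w. (w - z) * g w)"
  have "isCont g z" using assms(5) by (simp add: analytic_at_imp_isCont)
  then have "eventually (\<lambda>w. g w \<noteq> 0) (at z)"
    using assms(6) by (metis isCont_def tendsto_imp_eventually_ne)
  moreover have ne_z: "eventually (\<lambda>w. w \<noteq> z) (at z)" by (simp add: eventually_at_filter)
  ultimately have D_nz: "eventually (\<lambda>w. D w \<noteq> 0) (at z)"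
    by eventually_elim (simp add: D_def)
  have B_nz: "eventually (\<lambda>w. eval_fps B w \<noteq> 0) (at z)"
    using assms by (intro eventually_eval_fps_nonzero)
  have "eventually (\<lambda>w. w \<in> ball 0 \<rho>) (at z)"
    using assms(4) by (intro eventually_at_in_open') auto
  then have eq': "eventually (\<lambda>w. eval_fps A w * eval_fps A w =
      D w * (eval_fps B w * eval_fps B w)) (at z)"
    by eventually_elim (use eq in \<open>auto simp: D_def\<close>)
  from this B_nz D_nz have A_nz: "eventually (\<lambda>w. eval_fps A w * eval_fps A w \<noteq> 0) (at z)"
    by eventually_elim auto
  have BB_nz: "eventually (\<lambda>w. eval_fps B w * eval_fps B w \<noteq> 0) (at z)"
    using B_nz by eventually_elim auto
  have DBB_nz: "eventually (\<lambda>w. D w * (eval_fps B w * eval_fps B w) \<noteq> 0) (at z)"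
    using BB_nz D_nz by eventually_elim auto
  have an_A: "eval_fps A analytic_on {z}" and an_B: "eval_fps B analytic_on {z}"
    using assms(1,2,4) by (auto intro!: analytic_on_eval_fps intro: less_le_trans[of _ "ereal \<rho>"])
  have an_D: "D analytic_on {z}"
    unfolding D_def by (intro analytic_intros assms)
  obtain T where T: "open T" "z \<in> T" "g holomorphic_on T"
    using assms(5) by (auto simp: analytic_at)
  have "zorder D z = 1"
    by (rule zorder_eqI[OF T(1,2,3) assms(6)]) (simp add: D_def)
  moreover have "zorder (\<lambda>w. D w * (eval_fps B w * eval_fps B w)) z
      = zorder D z + (zorder (eval_fps B) z + zorder (eval_fps B) z)"
    using an_B an_D DBB_nz BB_nz
    by (simp add: zorder_times_analytic analytic_on_mult)
  moreover have "zorder (\<lambda>w. eval_fps A w * eval_fps A w) z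
      = zorder (eval_fps A) z + zorder (eval_fps A) z"
    using an_A A_nz by (intro zorder_times_analytic)
  moreover have "zorder (\<lambda>w. eval_fps A w * eval_fps A w) z
      = zorder (\<lambda>w. D w * (eval_fps B w * eval_fps B w)) z"
    using eq' by (intro zorder_cong) auto
  ultimately have "2 * zorder (eval_fps A) z = 1 + 2 * zorder (eval_fps B) z"
    by simp
  then show False by presburger
qed

section \<open>Digit sequences ending in 3\<close>

text \<open>
  The purely periodic sequence is its own tail, so the functional equation becomes
  \<open>Y\<^sup>2 - (1 + q + q\<^sup>2) Y + q\<^sup>2 = 0\<close>; completing the square gives
  \<open>(1 + q + q\<^sup>2)\<^sup>2 - 4 q\<^sup>2\<close> on the right.
\<close>

lemma q_cfrac_fps_threes_discriminant:
  defines "Y \<equiv> q_cfrac_fps (\<lambda>_. 3)"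
  shows "(2 * Y - (1 + fps_X + fps_X ^ 2)) ^ 2 =
    (1 + 3 * fps_X + fps_X ^ 2) * (1 - fps_X + fps_X ^ 2)"
proof -
  have "Y * Y = (\<Sum>i<3. fps_X ^ i) * Y - fps_X ^ 2"
    using q_cfrac_fps_unfold[of "\<lambda>_. 3"] by (simp add: Y_def)
  then have "Y * Y = (1 + fps_X + fps_X ^ 2) * Y - fps_X ^ 2"
    by (simp add: numeral_3_eq_3 power2_eq_square)
  then show ?thesis by algebra
qed

text \<open>
  Of the two real roots \<open>(\<plusminus>\<surd>5 - 3) / 2\<close> of \<open>1 + 3q + q\<^sup>2\<close>, the one closer to \<open>0\<close> has modulus
  \<open>(3 - \<surd>5) / 2\<close>.
\<close>

lemma threes_not_mero_on_disc:
  assumes "\<rho> > (3 - sqrt 5) / 2"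
  shows "fps_to_fls (q_cfrac_fps (\<lambda>_. 3)) \<notin> mero_on_disc \<rho>"
proof
  define Y where "Y = q_cfrac_fps (\<lambda>_. 3)"
  define T :: "complex fps" where "T = 1 + fps_X + fps_X ^ 2"
  define E :: "complex fps" where "E = (1 + 3 * fps_X + fps_X ^ 2) * (1 - fps_X + fps_X ^ 2)"
  define p where "p = [:1, 3, 1:] * [:1, -1, 1 :: complex:]"
  have E_poly: "E = fps_of_poly p"
    by (simp add: E_def p_def fps_of_poly_mult fps_of_poly_pCons algebra_simps power2_eq_square)
  assume "fps_to_fls (q_cfrac_fps (\<lambda>_. 3)) \<in> mero_on_disc \<rho>"
  then obtain A B where AB: "fps_to_fls Y = fps_to_fls A / fps_to_fls B" "B \<noteq> 0"
    "fps_conv_radius A \<ge> ereal \<rho>" "fps_conv_radius B \<ge> ereal \<rho>"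
    unfolding mero_on_disc_def Y_def by blast
  have "fps_to_fls (Y * B) = fps_to_fls A"
    using AB(1,2) by (simp add: fls_times_fps_to_fls)
  then have YB: "Y * B = A" by simp
  (* C / B is the square root 2 Y - T of the discriminant. *)
  define C where "C = (A - (T * B - A))"
  have T_poly: "T = fps_of_poly [:1, 1, 1:]"
    by (simp add: T_def fps_of_poly_pCons algebra_simps power2_eq_square)
  have rad_C: "fps_conv_radius C \<ge> ereal \<rho>"
    unfolding C_def T_poly using AB
    by (intro fps_conv_radius_diff_ge fps_conv_radius_mult_ge) auto
  have "C = (2 * Y - T) * B" by (simp add: C_def YB[symmetric] algebra_simps)
  then have "C * C = (2 * Y - T) ^ 2 * (B * B)"
    by (simp only: power2_eq_square mult_ac)
  also have "(2 * Y - T) ^ 2 = E"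
    unfolding Y_def T_def E_def by (rule q_cfrac_fps_threes_discriminant)
  finally have CC: "C * C = E * (B * B)" .
  define s where "s = sqrt 5"
  have s: "s * s = 5" "s > 2" "s < 3"
    by (auto simp: s_def real_less_rsqrt real_less_lsqrt)
  define z :: complex where "z = of_real ((s - 3) / 2)"
  define z' :: complex where "z' = of_real ((- s - 3) / 2)"
  define g where "g = (\<lambda>w. (w - z') * (1 - w + w ^ 2))"
  have root: "1 + 3 * w + w ^ 2 = (w - z) * (w - z')" for w
  proof -
    have "z + z' = -3" "z * z' = 1"
      using s(1) by (auto simp: z_def z'_def field_simps simp flip: of_real_add of_real_mult)
    then show ?thesis by algebra
  qed
  have "norm z = (3 - s) / 2" using s by (simp add: z_def flip: of_real_diff)
  then have z: "norm z < \<rho>" using assms by (simp add: s_def)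
  have "z \<noteq> z'" using s(2) by (simp add: z_def z'_def)
  moreover have "1 - z + z ^ 2 \<noteq> 0"
  proof -
    have "1 - z + z ^ 2 = of_real (1 - (s - 3) / 2 + ((s - 3) / 2) ^ 2)"
      by (simp add: z_def)
    moreover have "1 - (s - 3) / 2 + ((s - 3) / 2) ^ 2 > 0"
      using s by (simp add: add_pos_nonneg)
    ultimately show ?thesis by (metis less_irrefl of_real_eq_0_iff)
  qed
  ultimately have g_z: "g z \<noteq> 0" by (simp add: g_def)
  show False
  proof (rule square_eq_mult_square_simple_zero[of \<rho> C B z g])
    show "g analytic_on {z}" unfolding g_def by (intro analytic_intros)
  next
    fix w :: complex assume w: "norm w < \<rho>"
    then have w': "norm w < fps_conv_radius B" "norm w < fps_conv_radius C"
      using AB(4) rad_C by (auto intro: less_le_trans[of _ "ereal \<rho>"])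
    have "norm w < fps_conv_radius (B * B)"
      using fps_conv_radius_mult_ge[OF AB(4,4)] w by (auto intro: less_le_trans[of _ "ereal \<rho>"])
    then have "eval_fps C w * eval_fps C w = eval_fps E w * (eval_fps B w * eval_fps B w)"
      using arg_cong[OF CC, of "\<lambda>F. eval_fps F w"] w' by (simp add: eval_fps_mult E_poly)
    also have "eval_fps E w = (1 + 3 * w + w ^ 2) * (1 - w + w ^ 2)"
      by (simp add: E_poly p_def algebra_simps power2_eq_square)
    also have "\<dots> = (w - z) * g w" by (simp add: root g_def)
    finally show "eval_fps C w * eval_fps C w = (w - z) * g w * (eval_fps B w * eval_fps B w)" .
  qed (use rad_C AB z g_z in auto)
qed

text \<open>
  Otherwise the coefficients would be \<open>O(\<rho>\<^sup>-\<^sup>n)\<close>, the series would converge on the disc of radius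
  \<open>\<rho>\<close>, and its tail of digits \<open>3\<close> would be meromorphic there.
\<close>

lemma large_coefficient:
  assumes ge2: "\<forall>j. c j \<ge> 2" and threes: "\<And>j. j \<ge> m \<Longrightarrow> c j = 3"
    and \<rho>: "\<rho> > (3 - sqrt 5) / 2"
  shows "\<exists>n\<ge>k. norm (q_cfrac_fps c $ n) * \<rho> ^ n \<ge> 1"
proof (rule ccontr)
  assume small: "\<not> ?thesis"
  have "sqrt 5 < (3::real)" by (simp add: real_less_lsqrt)
  then have "(3 - sqrt 5) / 2 > 0" by simp
  then have pos: "\<rho> > 0" using \<rho> by linarith
  have "fps_conv_radius (q_cfrac_fps c) \<ge> ereal \<rho>"
    unfolding fps_conv_radius_def
  proof (rule conv_radius_geI_ex')
    fix r assume r: "0 < r" "ereal r < ereal \<rho>"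
    have "summable (\<lambda>n. (r / \<rho>) ^ n)" using r pos by (intro summable_geometric) auto
    then show "summable (\<lambda>n. q_cfrac_fps c $ n * complex_of_real r ^ n)"
    proof (rule summable_comparison_test_ev[rotated])
      show "\<forall>\<^sub>F n in sequentially.
          norm (q_cfrac_fps c $ n * complex_of_real r ^ n) \<le> (r / \<rho>) ^ n"
        using eventually_ge_at_top[of k]
      proof eventually_elim
        case (elim n)
        then have "norm (q_cfrac_fps c $ n) * \<rho> ^ n \<le> 1" using small by force
        then have "norm (q_cfrac_fps c $ n) \<le> 1 / \<rho> ^ n" using pos by (simp add: field_simps)
        then have "norm (q_cfrac_fps c $ n) * r ^ n \<le> 1 / \<rho> ^ n * r ^ n"
          using r by (intro mult_right_mono) auto
        then show ?case using r by (simp add: norm_mult norm_power power_divide)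
      qed
    qed
  qed
  then have "fps_to_fls (q_cfrac_fps (\<lambda>j. c (m + j))) \<in> mero_on_disc \<rho>"
    by (intro mero_on_disc_tail mero_on_discI ge2)
  moreover have "(\<lambda>j. c (m + j)) = (\<lambda>_. 3)" using threes by auto
  ultimately show False using threes_not_mero_on_disc[OF \<rho>] by simp
qed

lemma fps_conv_radius_le_of_large_coefficients:
  fixes F :: "complex fps"
  assumes "R > 0" "\<And>k. \<exists>n\<ge>k. norm (F $ n) * (R + 1 / real (Suc k)) ^ n \<ge> 1"
  shows "fps_conv_radius F \<le> ereal R"
proof (rule ccontr)
  assume "\<not> ?thesis"
  then obtain r where r: "ereal R < ereal r" "ereal r < fps_conv_radius F"
    using ereal_dense2[of "ereal R"] by (metis not_le)
  have "summable (\<lambda>n. F $ n * of_real r ^ n)"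
    using r assms(1) by (intro summable_fps) auto
  then have "(\<lambda>n. norm (F $ n * of_real r ^ n)) \<longlonglongrightarrow> 0"
    by (intro tendsto_norm_zero summable_LIMSEQ_zero)
  then have "eventually (\<lambda>n. norm (F $ n * of_real r ^ n) < 1) sequentially"
    by (rule order_tendstoD) simp
  moreover have "eventually (\<lambda>k. 1 / real (Suc k) < r - R) sequentially"
    using r by (intro order_tendstoD(2)[OF LIMSEQ_Suc[OF lim_1_over_n]]) auto
  ultimately obtain k where k: "\<And>n. n \<ge> k \<Longrightarrow> norm (F $ n * of_real r ^ n) < 1"
    "1 / real (Suc k) < r - R"
    unfolding eventually_sequentially by (metis le_cases order_trans)
  obtain n where n: "n \<ge> k" "norm (F $ n) * (R + 1 / real (Suc k)) ^ n \<ge> 1"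
    using assms(2) by blast
  have "(R + 1 / real (Suc k)) ^ n \<le> r ^ n"
    using k(2) assms(1) by (intro power_mono add_nonneg_nonneg) auto
  then have "norm (F $ n) * (R + 1 / real (Suc k)) ^ n \<le> norm (F $ n) * r ^ n"
    by (intro mult_left_mono) auto
  also have "\<dots> = norm (F $ n * of_real r ^ n)"
    using r assms(1) by (simp add: norm_mult norm_power)
  also have "\<dots> < 1" using k(1) n(1) by blast
  finally show False using n(2) by simp
qed

section \<open>The diagonal construction\<close>

text \<open>
  A stage of the construction is a pair \<open>(c, m)\<close> in which the digits of \<open>c\<close> before
  position \<open>m\<close> are final.
\<close>

lemma diagonal_digits:
  fixes e :: "nat \<Rightarrow> nat \<Rightarrow> nat"
  obtains c where "\<forall>j. c j \<ge> 2" "\<And>k. c \<noteq> e k"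
    "fps_conv_radius (q_cfrac_fps c) \<le> ereal ((3 - sqrt 5) / 2)"
proof -
  define R where "R = (3 - sqrt 5) / 2"
  define large where "large = (\<lambda>k c n. norm (q_cfrac_fps c $ n) * (R + 1 / real (Suc k)) ^ n \<ge> 1)"
  define good where "good = (\<lambda>(c :: nat \<Rightarrow> nat, m :: nat). \<forall>j. c j \<ge> 2)"
  define step where "step = (\<lambda>k (c, m) (c', m').
      m < m' \<and> (\<forall>j<m. c' j = c j) \<and> (\<exists>n\<ge>k. n < m' \<and> large k c' n) \<and> (\<exists>j<m'. c' j \<noteq> e k j))"
  have "\<exists>s. \<forall>k. good (s k) \<and> step k (s k) (s (Suc k))"
  proof (rule dependent_nat_choice)
    show "\<exists>s. good s" unfolding good_def by (auto intro: exI[of _ "\<lambda>_. 2"])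
  next
    fix s k assume s: "good s"
    obtain c m where [simp]: "s = (c, m)" by force
    have ge2: "\<forall>j. c j \<ge> 2" using s by (simp add: good_def)
    (* Replacing the undecided digits by 3 forces a large coefficient, at index n say. *)
    define d where "d = (\<lambda>j. if j < m then c j else 3)"
    have d: "\<forall>j. d j \<ge> 2" using ge2 by (simp add: d_def)
    obtain n where n: "n \<ge> k" "large k d n"
      using large_coefficient[OF d, of m "R + 1 / real (Suc k)" k]
      by (auto simp: d_def R_def large_def)
    (* Position l lies beyond the digits 0, ..., n, so changing the digit there
       leaves coefficient n intact. *)
    define l where "l = max m (Suc n)"
    define c' where "c' = d(l := if e k l = 2 then 3 else 2)"
    have c': "\<forall>j. c' j \<ge> 2" using d by (simp add: c'_def)
    have "q_cfrac_fps c' $ n = q_cfrac_fps d $ n"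
      by (rule q_cfrac_fps_nth_cong[OF c' d]) (auto simp: c'_def l_def)
    then have "large k c' n" using n by (simp add: large_def)
    moreover have "\<forall>j<m. c' j = c j" by (auto simp: c'_def l_def d_def)
    moreover have "c' l \<noteq> e k l" by (simp add: c'_def)
    moreover have "m < Suc l" "n < Suc l" by (auto simp: l_def)
    ultimately have "step k s (c', Suc l)"
      unfolding step_def using n(1) by auto
    then show "\<exists>t. good t \<and> step k s t"
      using c' by (auto simp: good_def)
  qed
  then obtain s where s: "\<And>k. good (s k)" "\<And>k. step k (s k) (s (Suc k))" by blast
  define d where "d = (\<lambda>k. fst (s k))"
  define m where "m = (\<lambda>k. snd (s k))"
  have sk: "s k = (d k, m k)" for k by (simp add: d_def m_def)
  have ge2: "\<forall>j. d k j \<ge> 2" for k using s(1)[of k] by (simp add: good_def sk)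
  have m_less: "m k < m (Suc k)" for k using s(2)[of k] by (simp add: step_def sk)
  have m_mono: "m k \<le> m k'" if "k \<le> k'" for k k'
    using lift_Suc_mono_le[of m k k'] m_less that by (simp add: less_imp_le)
  have m_ge: "k \<le> m k" for k
    using m_less strict_mono_imp_increasing[of m k] by (simp add: strict_mono_Suc_iff)
  have agree_Suc: "d (Suc k) j = d k j" if "j < m k" for k j
    using s(2)[of k] that by (simp add: step_def sk)
  have agree: "d k' j = d k j" if "k \<le> k'" "j < m k" for k k' j
    using that
  proof (induction k' rule: dec_induct)
    case (step i)
    then show ?case using agree_Suc[of j i] m_mono[of k i] by simp
  qed simp
  (* At stage j only m j \<ge> j is known, so digit j is final from stage Suc j on. *)
  define c where "c = (\<lambda>j. d (Suc j) j)"
  have c_eq: "c j = d k j" if "j < m k" for j k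
  proof -
    have "j < m (Suc j)" using m_ge[of "Suc j"] by simp
    then show ?thesis
      unfolding c_def using agree[of "Suc j" k j] agree[of k "Suc j" j] that by (metis le_cases)
  qed
  have c_ge2: "\<forall>j. c j \<ge> 2" using ge2 by (simp add: c_def)
  have "c \<noteq> e k" for k
  proof -
    obtain j where "j < m (Suc k)" "d (Suc k) j \<noteq> e k j"
      using s(2)[of k] by (auto simp: step_def sk)
    then show ?thesis using c_eq[of j "Suc k"] by metis
  qed
  moreover have "fps_conv_radius (q_cfrac_fps c) \<le> ereal R"
  proof (rule fps_conv_radius_le_of_large_coefficients)
    have "sqrt 5 < (3::real)" by (simp add: real_less_lsqrt)
    then show "R > 0" by (simp add: R_def)
  next
    fix k
    obtain n where n: "n \<ge> k" "n < m (Suc k)" "large k (d (Suc k)) n"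
      using s(2)[of k] by (auto simp: step_def sk)
    have "q_cfrac_fps c $ n = q_cfrac_fps (d (Suc k)) $ n"
      using n(2) by (intro q_cfrac_fps_nth_cong c_ge2 ge2 c_eq) auto
    then show "\<exists>n\<ge>k. norm (q_cfrac_fps c $ n) * (R + 1 / real (Suc k)) ^ n \<ge> 1"
      using n by (auto simp: large_def)
  qed
  ultimately show ?thesis using that c_ge2 unfolding R_def by blast
qed

lemma countable_PSL2Z_orbit: "countable (PSL2Z_orbit x)"
proof -
  define f where "f = (\<lambda>(a, b, c, d :: int).
    (of_int a * x + of_int b) / (of_int c * x + of_int d))"
  have "PSL2Z_orbit x \<subseteq> range f"
    unfolding PSL2Z_orbit_def f_def by (force simp: image_iff)
  then show ?thesis by (rule countable_subset) simp
qed

theorem mainTheorem6: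
  shows "uncountable {x :: real. x \<notin> PSL2Z_orbit ((1 + sqrt 5) / 2) \<and>
           fls_conv_radius (q_real x) \<le> ereal ((3 - sqrt 5) / 2)}"
    (is "uncountable ?S")
proof
  let ?O = "PSL2Z_orbit ((1 + sqrt 5) / 2)"
  assume "countable ?S"
  then have "countable (?S \<union> ?O)" by (simp add: countable_PSL2Z_orbit)
  then have "?S \<union> ?O \<subseteq> range (from_nat_into (?S \<union> ?O))"
    by (rule subset_range_from_nat_into)
  then obtain x :: "nat \<Rightarrow> real" where x: "?S \<union> ?O \<subseteq> range x"
    by blast
  obtain c where c: "\<forall>j. c j \<ge> 2" "\<And>k. c \<noteq> neg_cfrac_digits (x k)"
    "fps_conv_radius (q_cfrac_fps c) \<le> ereal ((3 - sqrt 5) / 2)"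
    using diagonal_digits[of "\<lambda>k. neg_cfrac_digits (x k)"] by blast
  obtain y where y: "is_neg_cfrac_expansion c y" "y \<ge> 1"
    using neg_cfrac_expansion_exists[OF c(1)] by blast
  have "y \<notin> range x"
    using c(2) neg_cfrac_digits_eq[OF y(1)] by auto
  moreover have "fls_conv_radius (q_real y) \<le> ereal ((3 - sqrt 5) / 2)"
    using c(3) by (simp add: q_real_eq_fps[OF y] fls_conv_radius_def)
  ultimately show False using x by blast
qed

end
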